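(* For every composition $\alpha=[\alpha_1,\dots,\alpha_m]$, \[{\mathfrak S}_\alpha=\sum_{\sigma\in S_m}(-1)^{\sigma}\,H_{(\alpha_1+\sigma_1-1,\ \alpha_2+\sigma_2-2,\ \dots,\ \alpha_m+\sigma_m-m)},\] where $(-1)^\sigma$ is the sign of the permutation $\sigma$.
   Context: Work over $\mathbb{Q}$. A composition is a finite sequence of positive integers. $\mathsf{NSym}$ is the free associative $\mathbb{Q}$-algebra on $H_1,H_2,\dots$ ($\deg H_i=i$); for an integer tuple, $H_{(a_1,\dots,a_m)}=H_{a_1}H_{a_2}\cdots H_{a_m}$ (noncommutative product in this order) with $H_0=1$ and $H_{-r}=0$ for $r>0$. $\mathsf{QSym}$ has monomial basis $M_\alpha=\sum_{i_1<\dots<i_m}x_{i_1}^{\alpha_1}\cdots x_{i_m}^{\alpha_m}$, paired with $\mathsf{NSym}$ by $\langle H_\alpha,M_\beta\rangle=\delta_{\alpha,\beta}$; for $F\in\mathsf{QSym}$, $F^\perp$ on $\mathsf{NSym}$ is defined by $\langle F^\perp H,G\rangle=\langle H,FG\rangle$. With $D(\alpha)=\{\alpha_1,\alpha_1+\alpha_2,\dots,\alpha_1+\dots+\alpha_{m-1}\}$ and refinement $\alpha\le\beta$ iff $D(\beta)\subseteq D(\alpha)$, set $F_\alpha=\sum_{\beta\le\alpha}M_\beta$ and $F_{1^i}=F_{(1,\dots,1)}$ ($i$ ones, $F_{1^0}=1$). $\mathbb{B}_m=\sum_{i\ge0}(-1)^iH_{m+i}F_{1^i}^\perp$, and for $\alpha\in\mathbb{Z}^m$,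 ${\mathfrak S}_\alpha=\mathbb{B}_{\alpha_1}\cdots\mathbb{B}_{\alpha_m}(1)$. *)

theory Defs
  imports Complex_Main "HOL-Library.Poly_Mapping" "HOL-Library.Groups_Big_Fun"
    "HOL-Combinatorics.Permutations"
begin

typedef composition = "{xs :: nat list. 0 \<notin> set xs}"
  morphisms parts Comp
  by (intro exI[of _ "[]"]) simp

setup_lifting type_definition_composition

definition weight :: "composition \<Rightarrow> nat" where
  "weight \<alpha> = sum_list (parts \<alpha>)"

definition descents :: "composition \<Rightarrow> nat set" where
  "descents \<alpha> = {sum_list (take k (parts \<alpha>)) | k. 1 \<le> k \<and> k < length (parts \<alpha>)}"

text \<open>Refinement is a relation between compositions of the same integer.\<close>

definition refines :: "composition \<Rightarrow> composition \<Rightarrow> bool" where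
  "refines \<alpha> \<beta> \<longleftrightarrow> weight \<alpha> = weight \<beta> \<and> descents \<beta> \<subseteq> descents \<alpha>"

lift_definition ones :: "nat \<Rightarrow> composition" is "\<lambda>i. replicate i (1::nat)"
  by simp

text \<open>
  Under concatenation the compositions are the free monoid on the positive integers. It is
  written additively because \<^theory>\<open>HOL-Library.Poly_Mapping\<close> builds the convolution product from
  an additive monoid of exponents.
\<close>

instantiation composition :: monoid_add
begin

lift_definition zero_composition :: composition is "[]" by simp

lift_definition plus_composition :: "composition \<Rightarrow> composition \<Rightarrow> composition" is "(@)" by simp

instance by standard (transfer; simp)+

end

text \<open>
  The free associative algebra on \<open>H\<^sub>1, H\<^sub>2, \<dots>\<close> is the monoid algebra of the free monoid on the
  positive integers; the word \<open>H\<^sub>\<alpha>\<close> is \<open>Poly_Mapping.single \<alpha> 1\<close> (lemma \<open>H_tuple_parts\<close>).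
\<close>

type_synonym nsym = "composition \<Rightarrow>\<^sub>0 rat"

definition H :: "int \<Rightarrow> nsym" where
  "H r = (if r < 0 then 0 else if r = 0 then 1 else Poly_Mapping.single (Comp [nat r]) 1)"

definition H_tuple :: "int list \<Rightarrow> nsym" where
  "H_tuple as = prod_list (map H as)"

text \<open>
  Formal power series over the rationals in the variables \<open>x\<^sub>0, x\<^sub>1, x\<^sub>2, \<dots>\<close>, given by their coefficients;
  a monomial is the finitely supported function of its exponents.
\<close>

type_synonym series = "(nat \<Rightarrow>\<^sub>0 nat) \<Rightarrow> rat"

definition series_mult :: "series \<Rightarrow> series \<Rightarrow> series" where
  "series_mult F G = (\<lambda>e. \<Sum>(a, b) \<in> {(a, b). a + b = e}. F a * G b)"

text \<open>
  The coefficient of a monomial in \<open>M\<^sub>\<alpha>\<close> is the number of index sequences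
  \<open>i\<^sub>1 < \<dots> < i\<^sub>m\<close> that contribute this monomial to the sum defining \<open>M\<^sub>\<alpha>\<close>.
\<close>

definition M :: "composition \<Rightarrow> series" where
  "M \<alpha> = (\<lambda>e. of_nat (card {is :: nat list. sorted_wrt (<) is \<and> length is = length (parts \<alpha>) \<and>
      (\<Sum>j<length is. Poly_Mapping.single (is ! j) (parts \<alpha> ! j)) = e}))"

definition M_combination :: "(composition \<Rightarrow>\<^sub>0 rat) \<Rightarrow> series" where
  "M_combination c = (\<lambda>e. \<Sum>\<alpha> \<in> Poly_Mapping.keys c. Poly_Mapping.lookup c \<alpha> * M \<alpha> e)"

definition QSym :: "series set" where
  "QSym = range M_combination"

definition M_coords :: "series \<Rightarrow> (composition \<Rightarrow>\<^sub>0 rat)" where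
  "M_coords F = (THE c. F = M_combination c)"

text \<open>
  The bilinear form on \<open>nsym \<times> QSym\<close> with \<open>\<langle>H\<^sub>\<alpha>, M\<^sub>\<beta>\<rangle> = \<delta>\<^sub>\<alpha>\<^sub>\<beta>\<close>; see lemma \<open>pairing_H_M\<close>.
\<close>

definition pairing :: "nsym \<Rightarrow> series \<Rightarrow> rat" where
  "pairing h F = (\<Sum>\<alpha> \<in> Poly_Mapping.keys h. Poly_Mapping.lookup h \<alpha> * Poly_Mapping.lookup (M_coords F) \<alpha>)"

definition F_fund :: "composition \<Rightarrow> series" where
  "F_fund \<alpha> = (\<lambda>e. \<Sum>\<beta> \<in> {\<beta>. refines \<beta> \<alpha>}. M \<beta> e)"

definition perp :: "series \<Rightarrow> nsym \<Rightarrow> nsym" where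
  "perp F h = (THE h'. \<forall>G \<in> QSym. pairing h' G = pairing h (series_mult F G))"

text \<open>
  The sum over \<open>i\<close> has only finitely many nonzero terms, since \<open>F\<^sub>1\<^sub>i\<^sup>\<bottom>\<close> lowers degrees by \<open>i\<close>.
\<close>

definition B :: "int \<Rightarrow> nsym \<Rightarrow> nsym" where
  "B m h = Sum_any (\<lambda>i::nat. (-1) ^ i * H (m + int i) * perp (F_fund (ones i)) h)"

definition immaculate :: "int list \<Rightarrow> nsym" where
  "immaculate \<alpha> = foldr B \<alpha> 1"

lemma H_pos: "0 < n \<Longrightarrow> H (int n) = Poly_Mapping.single (Comp [n]) 1"
  by (simp add: H_def)

lemma H_tuple_parts: "H_tuple (map int (parts \<alpha>)) = Poly_Mapping.single \<alpha> 1"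
proof -
  have "H_tuple (map int xs) = Poly_Mapping.single (Comp xs) 1" if "0 \<notin> set xs" for xs
    using that
  proof (induction xs)
    case Nil
    then show ?case
      by (simp add: H_tuple_def zero_composition_def flip: single_one)
  next
    case (Cons x xs)
    have "Comp [x] + Comp xs = Comp (x # xs)"
      using Cons.prems by (simp add: plus_composition_def Comp_inverse)
    with Cons show ?case
      by (simp add: H_tuple_def H_pos mult_single)
  qed
  from this[of "parts \<alpha>"] show ?thesis
    using parts[of \<alpha>] by (simp add: parts_inverse)
qed

definition initial_monomial :: "composition \<Rightarrow> (nat \<Rightarrow>\<^sub>0 nat)" where
  "initial_monomial \<beta> = (\<Sum>j<length (parts \<beta>). Poly_Mapping.single j (parts \<beta> ! j))"

lemma lookup_sum_single:
  fixes "is" :: "nat list"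
  assumes "distinct is" "k < length is"
  shows "Poly_Mapping.lookup (\<Sum>j<length is. Poly_Mapping.single (is ! j) (f j)) (is ! k) = (f k :: nat)"
proof -
  have "Poly_Mapping.lookup (\<Sum>j<length is. Poly_Mapping.single (is ! j) (f j)) (is ! k)
      = (\<Sum>j<length is. if j = k then f j else 0)"
    unfolding lookup_sum
    by (intro sum.cong) (use assms in \<open>auto simp: lookup_single when_def nth_eq_iff_index_eq\<close>)
  then show ?thesis using assms by simp
qed

lemma keys_sum_single:
  fixes "is" :: "nat list"
  assumes "distinct is" "\<And>j. j < length is \<Longrightarrow> f j \<noteq> (0::nat)"
  shows "Poly_Mapping.keys (\<Sum>j<length is. Poly_Mapping.single (is ! j) (f j)) = set is"
proof
  show "set is \<subseteq> Poly_Mapping.keys (\<Sum>j<length is. Poly_Mapping.single (is ! j) (f j))"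
    using assms by (auto simp: in_keys_iff in_set_conv_nth lookup_sum_single)
  show "Poly_Mapping.keys (\<Sum>j<length is. Poly_Mapping.single (is ! j) (f j)) \<subseteq> set is"
  proof
    fix x assume "x \<in> Poly_Mapping.keys (\<Sum>j<length is. Poly_Mapping.single (is ! j) (f j))"
    then have "(\<Sum>j<length is. Poly_Mapping.lookup (Poly_Mapping.single (is ! j) (f j)) x) \<noteq> 0"
      by (simp add: in_keys_iff lookup_sum)
    then obtain j where "j < length is" "Poly_Mapping.lookup (Poly_Mapping.single (is ! j) (f j)) x \<noteq> 0"
      by (meson lessThan_iff sum.not_neutral_contains_not_neutral)
    then show "x \<in> set is"
      by (auto simp: lookup_single when_def split: if_splits)
  qed
qed

lemma parts_nth_nonzero: "j < length (parts \<alpha>) \<Longrightarrow> parts \<alpha> ! j \<noteq> 0"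
  using parts[of \<alpha>] by (metis mem_Collect_eq nth_mem)

lemma M_initial_monomial: "M \<alpha> (initial_monomial \<beta>) = (if \<alpha> = \<beta> then 1 else 0)"
proof -
  let ?S = "{is :: nat list. sorted_wrt (<) is \<and> length is = length (parts \<alpha>) \<and>
      (\<Sum>j<length is. Poly_Mapping.single (is ! j) (parts \<alpha> ! j)) = initial_monomial \<beta>}"
  define n where "n = length (parts \<beta>)"
  have init: "initial_monomial \<beta>
      = (\<Sum>j<length [0..<n]. Poly_Mapping.single ([0..<n] ! j) (parts \<beta> ! j))"
    by (simp add: initial_monomial_def n_def)
  have *: "is = [0..<n] \<and> \<alpha> = \<beta>" if "is \<in> ?S" for "is"
  proof -
    from that have sorted: "sorted_wrt (<) is" and len: "length is = length (parts \<alpha>)"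
      and eq: "(\<Sum>j<length is. Poly_Mapping.single (is ! j) (parts \<alpha> ! j)) = initial_monomial \<beta>"
      by auto
    have "set is = Poly_Mapping.keys (initial_monomial \<beta>)"
      unfolding eq[symmetric]
      by (rule keys_sum_single[symmetric])
        (use sorted len parts_nth_nonzero in \<open>auto simp: strict_sorted_iff\<close>)
    also have "\<dots> = set [0..<n]"
      unfolding init by (rule keys_sum_single) (use parts_nth_nonzero in \<open>auto simp: n_def\<close>)
    finally have is_eq: "is = [0..<n]"
      using sorted by (intro sorted_distinct_set_unique) (auto simp: strict_sorted_iff)
    have "parts \<alpha> = parts \<beta>"
    proof (rule nth_equalityI)
      show l: "length (parts \<alpha>) = length (parts \<beta>)"
        using len is_eq by (simp add: n_def)
      fix k assume "k < length (parts \<alpha>)"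
      then have k: "k < length [0..<n]" using l by (simp add: n_def)
      show "parts \<alpha> ! k = parts \<beta> ! k"
        using lookup_sum_single[OF distinct_upt k, of "\<lambda>j. parts \<alpha> ! j"]
          lookup_sum_single[OF distinct_upt k, of "\<lambda>j. parts \<beta> ! j"] eq
        unfolding is_eq init by simp
    qed
    then show ?thesis using is_eq by (simp add: parts_inject)
  qed
  show ?thesis
  proof (cases "\<alpha> = \<beta>")
    case True
    then have "[0..<n] \<in> ?S"
      by (simp add: init n_def)
    with * have "?S = {[0..<n]}" by blast
    then have "card ?S = 1" by simp
    then show ?thesis using True by (simp add: M_def)
  next
    case False
    with * have "?S = {}" by blast
    then have "card ?S = 0" by (metis card.empty)
    then show ?thesis using False by (simp add: M_def)
  qed
qed

lemma M_combination_initial_monomial: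
  "M_combination c (initial_monomial \<beta>) = Poly_Mapping.lookup c \<beta>"
  by (simp add: M_combination_def M_initial_monomial in_keys_iff if_distrib sum.delta cong: if_cong)

lemma inj_M_combination: "inj M_combination"
  by (rule injI, rule poly_mapping_eqI) (metis M_combination_initial_monomial)

lemma M_coords_M_combination [simp]: "M_coords (M_combination c) = c"
  unfolding M_coords_def
  by (rule the_equality) (auto dest: injD[OF inj_M_combination])

lemma M_combination_single: "M_combination (Poly_Mapping.single \<beta> 1) = M \<beta>"
  by (simp add: M_combination_def)

lemma pairing_H_M:
  "pairing (H_tuple (map int (parts \<alpha>))) (M \<beta>) = (if \<alpha> = \<beta> then 1 else 0)"
  by (simp add: pairing_def H_tuple_parts lookup_single when_def flip: M_combination_single)

end

theory Submission
  imports Defs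
begin

text \<open>
  The operator dual to multiplication by \<open>F\<^sub>1\<^sub>i\<close>, the \<open>i\<close>-th elementary symmetric function, maps
  \<open>H\<^sub>v\<close> to the sum of all \<open>H\<^sub>w\<close> where \<open>w\<close> arises from \<open>v\<close> by lowering \<open>i\<close> entries by one. Consider the
  noncommutative determinants \<open>\<Sum>\<^sub>\<tau> (-1)\<^sup>\<tau> \<Prod>\<^sub>x H(a\<^sub>x + t(\<tau> x))\<close>, which are alternating in the column
  labels \<open>t\<close>. The dual operator lowers \<open>i\<close> of the labels, and if these are consecutive integers then two
  labels collide unless the \<open>i\<close> smallest ones are lowered. Hence the alternating sum
  defining \<open>B\<close> is the expansion of a determinant with one more row along its first row.
\<close>

section \<open>Monomials, their exponent sequences and the coefficients of quasisymmetric
  functions\<close>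

text \<open>Zero exponents are allowed, so that dividing by some of the variables leaves the index
  set \<open>A\<close> unchanged.\<close>

definition monom_on :: "nat set \<Rightarrow> (nat \<Rightarrow> nat) \<Rightarrow> (nat \<Rightarrow>\<^sub>0 nat)" where
  "monom_on A v = (\<Sum>x\<in>A. Poly_Mapping.single x (v x))"

text \<open>The invariant on which quasisymmetric coefficients depend: as a composition it names the
  unique \<open>M \<alpha>\<close> in which the monomial \<open>e\<close> occurs.\<close>

definition expo :: "(nat \<Rightarrow>\<^sub>0 nat) \<Rightarrow> nat list" where
  "expo e = map (Poly_Mapping.lookup e) (sorted_list_of_set (Poly_Mapping.keys e))"

lemma lookup_monom_on:
  "finite A \<Longrightarrow> Poly_Mapping.lookup (monom_on A v) x = (if x \<in> A then v x else 0)"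
  by (simp add: monom_on_def lookup_sum lookup_single when_def)

lemma keys_monom_on: "finite A \<Longrightarrow> Poly_Mapping.keys (monom_on A v) = {x \<in> A. v x \<noteq> 0}"
  by (auto simp: in_keys_iff lookup_monom_on split: if_splits)

lemma monom_on_keys: "monom_on (Poly_Mapping.keys e) (Poly_Mapping.lookup e) = e"
  by (rule poly_mapping_eqI) (simp add: lookup_monom_on in_keys_iff)

lemma monom_on_cong: "(\<And>x. x \<in> A \<Longrightarrow> v x = w x) \<Longrightarrow> monom_on A v = monom_on A w"
  by (simp add: monom_on_def)

lemma zero_notin_expo [simp]: "0 \<notin> set (expo e)"
  by (auto simp: expo_def in_keys_iff)

lemma parts_Comp_expo [simp]: "parts (Comp (expo e)) = expo e"
  by (simp add: Comp_inverse)

lemma sorted_list_of_set_Collect: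
  fixes A :: "nat set"
  assumes "finite A"
  shows "sorted_list_of_set {x \<in> A. P x} = filter P (sorted_list_of_set A)"
  using assms
  by (intro sorted_distinct_set_unique) (auto intro: sorted_wrt_filter)

lemma expo_monom_on:
  assumes "finite A"
  shows "expo (monom_on A v) = filter (\<lambda>k. k \<noteq> 0) (map v (sorted_list_of_set A))"
proof -
  have "map (Poly_Mapping.lookup (monom_on A v)) (filter (\<lambda>x. v x \<noteq> 0) (sorted_list_of_set A))
      = map v (filter (\<lambda>x. v x \<noteq> 0) (sorted_list_of_set A))"
    using assms by (intro map_cong) (auto simp: lookup_monom_on)
  then show ?thesis
    using assms
    by (simp add: expo_def keys_monom_on sorted_list_of_set_Collect filter_map comp_def)
qed

lemma sorted_list_of_set_image_strict_mono:
  fixes \<phi> :: "nat \<Rightarrow> nat"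
  assumes "finite A" "strict_mono_on A \<phi>"
  shows "sorted_list_of_set (\<phi> ` A) = map \<phi> (sorted_list_of_set A)"
proof (rule sorted_distinct_set_unique[symmetric])
  have "mono_on A \<phi>" "inj_on \<phi> A"
    using assms(2) by (auto intro: strict_mono_on_imp_mono_on strict_mono_on_imp_inj_on)
  then show "sorted (map \<phi> (sorted_list_of_set A))" "distinct (map \<phi> (sorted_list_of_set A))"
    using assms(1) by (auto simp: distinct_map mono_on_def sorted_map intro!: sorted_wrt_mono_rel[OF _ sorted_sorted_list_of_set])
qed (use assms(1) in auto)

lemma expo_monom_on_image:
  assumes "finite A" "strict_mono_on A \<phi>"
  shows "expo (monom_on (\<phi> ` A) v) = expo (monom_on A (\<lambda>x. v (\<phi> x)))"
  using assms by (simp add: expo_monom_on sorted_list_of_set_image_strict_mono comp_def)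

lemma initial_monomial_eq_monom_on:
  "initial_monomial \<alpha> = monom_on {..<length (parts \<alpha>)} ((!) (parts \<alpha>))"
  by (simp add: initial_monomial_def monom_on_def)

lemma expo_initial_monomial [simp]: "expo (initial_monomial \<alpha>) = parts \<alpha>"
proof -
  have "filter (\<lambda>k. k \<noteq> 0) (parts \<alpha>) = parts \<alpha>"
    using parts[of \<alpha>] by (auto simp: filter_id_conv intro!: gr0I)
  then show ?thesis
    by (simp add: initial_monomial_eq_monom_on expo_monom_on lessThan_atLeast0 map_nth del: filter_True)
qed

text \<open>An increasing index sequence that contributes \<open>e\<close> has to be the sorted list
  of the keys of \<open>e\<close>, so the cardinality in the definition of \<open>M\<close> is 0 or
  1.\<close>

lemma M_eq: "M \<alpha> e = (if expo e = parts \<alpha> then 1 else 0)"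
proof -
  let ?S = "{is :: nat list. sorted_wrt (<) is \<and> length is = length (parts \<alpha>) \<and>
      (\<Sum>j<length is. Poly_Mapping.single (is ! j) (parts \<alpha> ! j)) = e}"
  let ?L = "sorted_list_of_set (Poly_Mapping.keys e)"
  have is_eq: "is = ?L \<and> expo e = parts \<alpha>" if "is \<in> ?S" for "is"
  proof -
    from that have sorted: "sorted_wrt (<) is" and len: "length is = length (parts \<alpha>)"
      and eq: "(\<Sum>j<length is. Poly_Mapping.single (is ! j) (parts \<alpha> ! j)) = e"
      by auto
    have dist: "distinct is" using sorted by (simp add: strict_sorted_iff)
    have "Poly_Mapping.keys e = set is"
      unfolding eq[symmetric] by (rule keys_sum_single) (use dist len parts_nth_nonzero in auto)
    then have L: "is = ?L"
      using sorted by (intro sorted_distinct_set_unique) (auto simp: strict_sorted_iff)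
    have "map (Poly_Mapping.lookup e) is = parts \<alpha>"
      using lookup_sum_single[OF dist, of _ "(!) (parts \<alpha>)"] len
      unfolding eq by (intro nth_equalityI) auto
    with L show ?thesis by (simp add: expo_def)
  qed
  show ?thesis
  proof (cases "expo e = parts \<alpha>")
    case True
    then have len: "length ?L = length (parts \<alpha>)"
      by (metis expo_def length_map)
    have "(\<Sum>j<length ?L. Poly_Mapping.single (?L ! j) (parts \<alpha> ! j))
        = (\<Sum>j<length ?L. Poly_Mapping.single (?L ! j) (Poly_Mapping.lookup e (?L ! j)))"
      unfolding True[symmetric] expo_def by (intro sum.cong) auto
    also have "\<dots> = (\<Sum>x\<in>Poly_Mapping.keys e. Poly_Mapping.single x (Poly_Mapping.lookup e x))"
      by (intro sum.reindex_bij_betw bij_betw_nth) auto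
    also have "\<dots> = e" using monom_on_keys[of e] by (simp add: monom_on_def)
    finally have "?L \<in> ?S" using len by simp
    with is_eq have "?S = {?L}" by blast
    then have "card ?S = 1" by (metis card_1_singleton_iff One_nat_def)
    then show ?thesis using True by (simp add: M_def)
  next
    case False
    with is_eq have "?S = {}" by blast
    then have "card ?S = 0" by (metis card.empty)
    then show ?thesis using False by (simp add: M_def)
  qed
qed

lemma M_combination_eq: "M_combination c e = Poly_Mapping.lookup c (Comp (expo e))"
proof -
  have "parts \<alpha> = expo e \<longleftrightarrow> \<alpha> = Comp (expo e)" for \<alpha>
    by (metis parts_Comp_expo parts_inverse)
  then have "M_combination c e
      = (\<Sum>\<alpha>\<in>Poly_Mapping.keys c. if \<alpha> = Comp (expo e) then Poly_Mapping.lookup c \<alpha> else 0)"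
    unfolding M_combination_def by (intro sum.cong refl) (simp add: M_eq eq_commute[of "expo e"])
  then show ?thesis by (simp add: in_keys_iff)
qed

lemma QSym_cong: "F \<in> QSym \<Longrightarrow> expo e = expo e' \<Longrightarrow> F e = F e'"
  by (auto simp: QSym_def M_combination_eq)

lemma lookup_M_coords:
  "F \<in> QSym \<Longrightarrow> Poly_Mapping.lookup (M_coords F) \<alpha> = F (initial_monomial \<alpha>)"
  by (auto simp: QSym_def M_combination_initial_monomial)

lemma M_in_QSym: "M \<beta> \<in> QSym"
  by (metis QSym_def M_combination_single rangeI)

text \<open>The coefficients at the initial monomials serve as coordinates in the basis
  \<open>M\<close>: \<open>fin\<close> makes them a finitely supported function, and
  \<open>inv\<close> propagates them to all other monomials.\<close>

lemma in_QSymI: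
  assumes fin: "finite {\<alpha>. F (initial_monomial \<alpha>) \<noteq> 0}"
    and inv: "\<And>e. F e = F (initial_monomial (Comp (expo e)))"
  shows "F \<in> QSym"
proof -
  have "M_combination (Abs_poly_mapping (\<lambda>\<alpha>. F (initial_monomial \<alpha>))) = F"
    by (rule ext) (simp add: M_combination_eq fin flip: inv)
  then show ?thesis unfolding QSym_def by (metis rangeI)
qed

section \<open>Multiplication by the elementary symmetric functions\<close>

lemma length_le_sum_list: "0 \<notin> set xs \<Longrightarrow> length xs \<le> sum_list (xs :: nat list)"
  by (induction xs) auto

lemma sum_list_filter_nonzero: "sum_list (filter (\<lambda>k. k \<noteq> 0) xs) = sum_list (xs :: nat list)"
  by (induction xs) auto

lemma finite_weight_le: "finite {\<alpha>. weight \<alpha> \<le> W}"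
proof -
  have "length (parts \<alpha>) \<le> weight \<alpha>" for \<alpha>
    using parts[of \<alpha>] by (auto simp: weight_def intro: length_le_sum_list)
  moreover have "x \<le> weight \<alpha>" if "x \<in> set (parts \<alpha>)" for x \<alpha>
    using that by (simp add: weight_def member_le_sum_list)
  ultimately have "parts ` {\<alpha>. weight \<alpha> \<le> W} \<subseteq> {xs. set xs \<subseteq> {..W} \<and> length xs \<le> W}"
    by (auto intro: order_trans)
  then have "finite (parts ` {\<alpha>. weight \<alpha> \<le> W})"
    by (rule finite_subset) (rule finite_lists_length_le, simp)
  moreover have "inj_on parts {\<alpha>. weight \<alpha> \<le> W}"
    by (simp add: inj_on_def parts_inject)
  ultimately show ?thesis by (rule finite_imageD)
qed

text \<open>The descents of \<open>ones i\<close> are all of \<open>{1..<i}\<close>. A refinement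
  therefore has at least \<open>i\<close> parts, and since they are positive with sum
  \<open>i\<close>, each of them is 1.\<close>

lemma F_fund_ones: "F_fund (ones i) = M (ones i)"
proof -
  have "\<beta> = ones i" if "refines \<beta> (ones i)" for \<beta>
  proof -
    let ?p = "parts \<beta>"
    have w: "sum_list ?p = i" and sub: "descents (ones i) \<subseteq> descents \<beta>"
      using that by (auto simp: refines_def weight_def ones.rep_eq sum_list_replicate)
    have "{1..<i} \<subseteq> descents (ones i)"
      by (auto simp: descents_def ones.rep_eq sum_list_replicate min_def intro!: exI)
    moreover have "descents \<beta> = (\<lambda>k. sum_list (take k ?p)) ` {1..<length ?p}"
      by (auto simp: descents_def)
    ultimately have "card {1..<i} \<le> card {1..<length ?p}"
      using sub by (metis card_image_le card_mono finite_atLeastLessThan finite_imageI le_trans subset_trans)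
    then have len: "i - 1 \<le> length ?p - 1" by simp
    have all1: "replicate (length xs) 1 = xs" if "0 \<notin> set xs" "sum_list xs \<le> length xs" for xs :: "nat list"
      using that
    proof (induction xs)
      case (Cons x xs)
      have "length xs \<le> sum_list xs" using Cons.prems by (intro length_le_sum_list) simp
      with Cons show ?case by (cases x) auto
    qed simp
    have "?p = replicate i 1"
    \<comment> \<open>Because of truncated subtraction, \<open>len\<close> yields
      \<open>i \<le> length ?p\<close> only for a nonempty list.\<close>
    proof (cases "?p = []")
      case True
      with w show ?thesis by simp
    next
      case False
      have "i \<le> length ?p" using False len by (cases ?p) auto
      moreover from this have "replicate (length ?p) 1 = ?p"
        by (intro all1) (use parts[of \<beta>] w in auto)
      moreover have "length ?p = i"
        using length_le_sum_list[of ?p] parts[of \<beta>] w \<open>i \<le> length ?p\<close> by simp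
      ultimately show ?thesis by simp
    qed
    then show ?thesis by (intro parts_inject[THEN iffD1]) (simp only: ones.rep_eq)
  qed
  then have "{\<beta>. refines \<beta> (ones i)} = {ones i}"
    unfolding refines_def by blast
  then show ?thesis by (simp add: F_fund_def)
qed

text \<open>Identifies the monomials of \<open>F_fund (ones i)\<close> as the squarefree ones of
  degree \<open>i\<close>.\<close>

lemma expo_eq_replicate_1_iff:
  "expo e = replicate i 1 \<longleftrightarrow>
    card (Poly_Mapping.keys e) = i \<and> (\<forall>x\<in>Poly_Mapping.keys e. Poly_Mapping.lookup e x = 1)"
proof -
  have "expo e = replicate i 1 \<longleftrightarrow> length (expo e) = i \<and> (\<forall>k\<in>set (expo e). k = 1)"
    by (metis in_set_replicate length_replicate replicate_eqI)
  then show ?thesis by (simp add: expo_def)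
qed

text \<open>The exponents of \<open>a\<close> are bounded by those of \<open>e\<close>, and
  \<open>a\<close> determines \<open>b\<close> by cancellation. The sum in
  \<open>series_mult\<close> ranges over this set and would default to 0 if it were
  infinite.\<close>

lemma finite_poly_mapping_splits:
  fixes e :: "nat \<Rightarrow>\<^sub>0 nat"
  shows "finite {(a, b). a + b = e}"
proof -
  let ?T = "{(a, b). a + b = e}"
  have le: "Poly_Mapping.lookup a x \<le> Poly_Mapping.lookup e x" if "(a, b) \<in> ?T" for a b x
    using that by (auto simp: lookup_add)
  let ?K = "Poly_Mapping.keys e"
  let ?B = "{..Max (Poly_Mapping.lookup e ` ?K)}"
  have "(\<lambda>(a, b). Poly_Mapping.lookup a) ` ?T
      \<subseteq> {f. \<forall>x. (x \<in> ?K \<longrightarrow> f x \<in> ?B) \<and> (x \<notin> ?K \<longrightarrow> f x = 0)}"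
  proof (clarify, intro conjI impI)
    fix a b x assume ab: "e = a + b"
    have l: "Poly_Mapping.lookup a x \<le> Poly_Mapping.lookup e x" using le ab by blast
    {
      assume "x \<in> Poly_Mapping.keys (a + b)"
      then have "Poly_Mapping.lookup e x \<le> Max (Poly_Mapping.lookup e ` ?K)"
        using ab by (intro Max_ge) auto
      with l show "Poly_Mapping.lookup a x \<in> {..Max (Poly_Mapping.lookup (a + b) ` Poly_Mapping.keys (a + b))}"
        using ab by simp
    }
    {
      assume "x \<notin> Poly_Mapping.keys (a + b)"
      with l ab show "Poly_Mapping.lookup a x = 0" by (simp add: in_keys_iff)
    }
  qed
  then have "finite ((\<lambda>(a, b). Poly_Mapping.lookup a) ` ?T)"
    by (rule finite_subset) (rule finite_set_of_finite_funs, auto)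
  moreover have "inj_on (\<lambda>(a, b). Poly_Mapping.lookup a) ?T"
    by (auto simp: inj_on_def lookup_inject)
  ultimately show ?thesis by (rule finite_imageD)
qed

text \<open>Only factorizations whose first factor is squarefree of degree \<open>i\<close>
  contribute. Such a factor is given by its set \<open>S\<close> of variables, and
  \<open>0 < v x\<close> on \<open>S\<close> expresses that it divides the monomial, so that the
  natural subtraction is exact.\<close>

lemma series_mult_F_fund_ones:
  assumes A: "finite A"
  shows "series_mult (F_fund (ones i)) G (monom_on A v) =
    (\<Sum>S | S \<subseteq> A \<and> card S = i \<and> (\<forall>x\<in>S. 0 < v x). G (monom_on A (\<lambda>x. v x - of_bool (x \<in> S))))"
proof -
  let ?e = "monom_on A v"
  let ?T = "{(a, b). a + b = ?e}"
  let ?T' = "{(a, b) \<in> ?T. expo a = replicate i 1}"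
  let ?S = "{S. S \<subseteq> A \<and> card S = i \<and> (\<forall>x\<in>S. 0 < v x)}"
  have E: "F_fund (ones i) a = (if expo a = replicate i 1 then 1 else 0)" for a
    by (simp add: F_fund_ones M_eq ones.rep_eq)
  have "series_mult (F_fund (ones i)) G ?e = (\<Sum>(a, b)\<in>?T. F_fund (ones i) a * G b)"
    by (simp add: series_mult_def)
  also have "\<dots> = (\<Sum>(a, b)\<in>?T'. F_fund (ones i) a * G b)"
    by (intro sum.mono_neutral_right finite_poly_mapping_splits) (auto simp: E split: if_splits)
  also have "\<dots> = (\<Sum>S\<in>?S. G (monom_on A (\<lambda>x. v x - of_bool (x \<in> S))))"
  proof (rule sum.reindex_bij_witness[where
        i = "\<lambda>S. (monom_on S (\<lambda>_. 1), monom_on A (\<lambda>x. v x - of_bool (x \<in> S)))"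
        and j = "\<lambda>(a, b). Poly_Mapping.keys a"])
    fix S assume S: "S \<in> ?S"
    then have fS: "finite S" using A finite_subset by auto
    then show "(case (monom_on S (\<lambda>_. 1), monom_on A (\<lambda>x. v x - of_bool (x \<in> S))) of
        (a, b) \<Rightarrow> Poly_Mapping.keys a) = S"
      by (simp add: keys_monom_on)
    have "monom_on S (\<lambda>_. 1) + monom_on A (\<lambda>x. v x - of_bool (x \<in> S)) = ?e"
      using S fS A by (intro poly_mapping_eqI) (auto simp: lookup_add lookup_monom_on)
    moreover have "expo (monom_on S (\<lambda>_. 1)) = replicate i 1"
      unfolding expo_eq_replicate_1_iff using S fS by (simp add: keys_monom_on lookup_monom_on)
    ultimately show "(monom_on S (\<lambda>_. 1), monom_on A (\<lambda>x. v x - of_bool (x \<in> S))) \<in> ?T'"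
      by simp
  next
    fix ab assume ab: "ab \<in> ?T'"
    obtain a b where ab_eq: "ab = (a, b)" by fastforce
    have sum: "Poly_Mapping.lookup a x + Poly_Mapping.lookup b x = (if x \<in> A then v x else 0)" for x
      using ab A by (auto simp: ab_eq lookup_monom_on simp flip: lookup_add)
    have card: "card (Poly_Mapping.keys a) = i"
      and one: "\<And>x. x \<in> Poly_Mapping.keys a \<Longrightarrow> Poly_Mapping.lookup a x = 1"
      using ab unfolding ab_eq by (auto simp: expo_eq_replicate_1_iff[simplified])
    have la: "Poly_Mapping.lookup a x = of_bool (x \<in> Poly_Mapping.keys a)" for x
      using one[of x] by (simp add: in_keys_iff)
    have vx: "x \<in> A \<and> 0 < v x" if "x \<in> Poly_Mapping.keys a" for x
      using sum[of x] one[OF that] by (auto split: if_splits)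
    then show "(case ab of (a, b) \<Rightarrow> Poly_Mapping.keys a) \<in> ?S"
      using card by (auto simp: ab_eq)
    have "monom_on (Poly_Mapping.keys a) (\<lambda>_. 1) = a"
      by (rule poly_mapping_eqI) (simp add: lookup_monom_on la)
    moreover have b: "monom_on A (\<lambda>x. v x - of_bool (x \<in> Poly_Mapping.keys a)) = b"
    proof (rule poly_mapping_eqI)
      fix x
      show "Poly_Mapping.lookup (monom_on A (\<lambda>x. v x - of_bool (x \<in> Poly_Mapping.keys a))) x
          = Poly_Mapping.lookup b x"
        using sum[of x] la[of x] A by (auto simp: lookup_monom_on split: if_splits)
    qed
    ultimately show "(monom_on (case ab of (a, b) \<Rightarrow> Poly_Mapping.keys a) (\<lambda>_. 1),
        monom_on A (\<lambda>x. v x - of_bool (x \<in> (case ab of (a, b) \<Rightarrow> Poly_Mapping.keys a)))) = ab"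
      by (simp add: ab_eq)
    show "G (monom_on A (\<lambda>x. v x - of_bool (x \<in> (case ab of (a, b) \<Rightarrow> Poly_Mapping.keys a))))
        = (case ab of (a, b) \<Rightarrow> F_fund (ones i) a * G b)"
      using ab b by (simp add: ab_eq E)
  qed
  finally show ?thesis .
qed

text \<open>\<open>pairing\<close> sees a series only through \<open>M_coords\<close>, which is
  meaningful on \<open>QSym\<close>. Multiplication raises weights by \<open>i\<close>, which gives
  finiteness; renumbering the variables in an order-preserving way permutes the sets
  \<open>S\<close>, which gives invariance.\<close>

lemma series_mult_F_fund_ones_in_QSym:
  assumes G: "G \<in> QSym"
  shows "series_mult (F_fund (ones i)) G \<in> QSym" (is "?P \<in> QSym")
proof (rule in_QSymI)
  obtain c where c: "\<And>e. G e = Poly_Mapping.lookup c (Comp (expo e))"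
    using G by (auto simp: QSym_def M_combination_eq)
  \<comment> \<open>The weights in the support of \<open>G\<close> are at most the maximum over the
    keys of \<open>c\<close>, and the product adds \<open>i\<close>.\<close>
  let ?W = "Max (weight ` Poly_Mapping.keys c) + i"
  have "weight \<alpha> \<le> ?W" if nz: "?P (initial_monomial \<alpha>) \<noteq> 0" for \<alpha>
  proof -
    let ?p = "parts \<alpha>" let ?n = "length (parts \<alpha>)"
    obtain S where S: "S \<subseteq> {..<?n}" "card S = i" "\<And>x. x \<in> S \<Longrightarrow> 0 < ?p ! x"
      and G_nz: "G (monom_on {..<?n} (\<lambda>x. ?p ! x - of_bool (x \<in> S))) \<noteq> 0"
      using nz unfolding initial_monomial_eq_monom_on
      by (subst (asm) series_mult_F_fund_ones) (auto elim!: sum.not_neutral_contains_not_neutral)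
    let ?w = "\<lambda>x. ?p ! x - of_bool (x \<in> S)"
    let ?\<gamma> = "Comp (expo (monom_on {..<?n} ?w))"
    have "?\<gamma> \<in> Poly_Mapping.keys c" using G_nz by (simp add: c in_keys_iff)
    then have "weight ?\<gamma> \<le> Max (weight ` Poly_Mapping.keys c)" by simp
    moreover have "weight ?\<gamma> = (\<Sum>x<?n. ?w x)"
      unfolding weight_def parts_Comp_expo
      by (simp only: expo_monom_on finite_lessThan sum_list_filter_nonzero
          sum_list_distinct_conv_sum_set sorted_list_of_set.distinct_sorted_key_list_of_set
          sorted_list_of_set.set_sorted_key_list_of_set)
    moreover have "weight \<alpha> = (\<Sum>x<?n. ?w x + of_bool (x \<in> S))"
      unfolding weight_def sum_list_sum_nth atLeast0LessThan
      by (intro sum.cong refl) (use S(3) in force)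
    moreover have "(\<Sum>x<?n. of_bool (x \<in> S) :: nat) = i"
      using S(1,2) by (simp add: of_bool_def sum.If_cases Int_absorb1)
    ultimately show ?thesis by (simp add: sum.distrib)
  qed
  then show "finite {\<alpha>. ?P (initial_monomial \<alpha>) \<noteq> 0}"
    by (intro finite_subset[OF _ finite_weight_le]) auto
next
  fix e :: "nat \<Rightarrow>\<^sub>0 nat"
  let ?K = "Poly_Mapping.keys e" let ?L = "sorted_list_of_set ?K" let ?v = "Poly_Mapping.lookup e"
  let ?n = "length ?L"
  \<comment> \<open>The order isomorphism from positions to the variables of \<open>e\<close>; it
    carries the initial monomial to \<open>e\<close>.\<close>
  let ?\<phi> = "(!) ?L"
  have mono: "strict_mono_on {..<?n} ?\<phi>"
    by (auto simp: strict_mono_on_def sorted_wrt_nth_less[OF strict_sorted_list_of_set])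
  have inj: "inj_on ?\<phi> {..<?n}" using mono by (rule strict_mono_on_imp_inj_on)
  have img: "?\<phi> ` {..<?n} = ?K"
    using bij_betw_nth[of ?L "{..<?n}" ?K] by (simp add: bij_betw_def)
  have "initial_monomial (Comp (expo e)) = monom_on {..<?n} (\<lambda>x. ?v (?\<phi> x))"
    unfolding initial_monomial_eq_monom_on parts_Comp_expo
    by (simp add: expo_def monom_on_def)
  then have "?P (initial_monomial (Comp (expo e))) =
      (\<Sum>S | S \<subseteq> {..<?n} \<and> card S = i \<and> (\<forall>x\<in>S. 0 < ?v (?\<phi> x)).
        G (monom_on {..<?n} (\<lambda>x. ?v (?\<phi> x) - of_bool (x \<in> S))))"
    by (simp add: series_mult_F_fund_ones)
  also have "\<dots> = (\<Sum>S | S \<subseteq> ?K \<and> card S = i \<and> (\<forall>x\<in>S. 0 < ?v x).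
        G (monom_on ?K (\<lambda>x. ?v x - of_bool (x \<in> S))))"
  proof (rule sum.reindex_bij_witness[where j = "\<lambda>S. ?\<phi> ` S" and i = "\<lambda>S. {x \<in> {..<?n}. ?\<phi> x \<in> S}"])
    fix S assume S: "S \<in> {S. S \<subseteq> {..<?n} \<and> card S = i \<and> (\<forall>x\<in>S. 0 < ?v (?\<phi> x))}"
    then have iff: "?\<phi> x \<in> ?\<phi> ` S \<longleftrightarrow> x \<in> S" if "x < ?n" for x
      using that inj by (auto dest: inj_onD)
    with S show "{x \<in> {..<?n}. ?\<phi> x \<in> ?\<phi> ` S} = S" by auto
    have "card (?\<phi> ` S) = card S" using S inj by (intro card_image) (auto intro: inj_on_subset)
    then show "?\<phi> ` S \<in> {S. S \<subseteq> ?K \<and> card S = i \<and> (\<forall>x\<in>S. 0 < ?v x)}"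
      using S img by auto
    have "expo (monom_on ?K (\<lambda>x. ?v x - of_bool (x \<in> ?\<phi> ` S)))
        = expo (monom_on {..<?n} (\<lambda>x. ?v (?\<phi> x) - of_bool (?\<phi> x \<in> ?\<phi> ` S)))"
      using expo_monom_on_image[OF _ mono] unfolding img by simp
    also have "monom_on {..<?n} (\<lambda>x. ?v (?\<phi> x) - of_bool (?\<phi> x \<in> ?\<phi> ` S))
        = monom_on {..<?n} (\<lambda>x. ?v (?\<phi> x) - of_bool (x \<in> S))"
      using iff by (intro monom_on_cong) simp
    finally show "G (monom_on ?K (\<lambda>x. ?v x - of_bool (x \<in> ?\<phi> ` S)))
        = G (monom_on {..<?n} (\<lambda>x. ?v (?\<phi> x) - of_bool (x \<in> S)))"
      by (rule QSym_cong[OF G])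
  next
    fix S assume S: "S \<in> {S. S \<subseteq> ?K \<and> card S = i \<and> (\<forall>x\<in>S. 0 < ?v x)}"
    show im: "?\<phi> ` {x \<in> {..<?n}. ?\<phi> x \<in> S} = S"
    proof -
      have "S \<subseteq> ?\<phi> ` {..<?n}" using S img by simp
      then show ?thesis by blast
    qed
    have "card (?\<phi> ` {x \<in> {..<?n}. ?\<phi> x \<in> S}) = card {x \<in> {..<?n}. ?\<phi> x \<in> S}"
      using inj by (intro card_image) (auto intro: inj_on_subset)
    with S show "{x \<in> {..<?n}. ?\<phi> x \<in> S} \<in> {S. S \<subseteq> {..<?n} \<and> card S = i \<and> (\<forall>x\<in>S. 0 < ?v (?\<phi> x))}"
      unfolding im by auto
  qed
  also have "\<dots> = ?P (monom_on ?K ?v)" by (simp add: series_mult_F_fund_ones)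
  finally show "?P e = ?P (initial_monomial (Comp (expo e)))" by (simp add: monom_on_keys)
qed

section \<open>The pairing and the dual operators on words in the generators\<close>

lemma pairing_superset:
  assumes "finite X" "Poly_Mapping.keys h \<subseteq> X"
  shows "pairing h F = (\<Sum>\<alpha>\<in>X. Poly_Mapping.lookup h \<alpha> * Poly_Mapping.lookup (M_coords F) \<alpha>)"
  unfolding pairing_def using assms by (intro sum.mono_neutral_left) (auto simp: in_keys_iff)

lemma pairing_0 [simp]: "pairing 0 F = 0"
  by (simp add: pairing_def)

lemma pairing_add: "pairing (g + h) F = pairing g F + pairing h F"
proof -
  let ?X = "Poly_Mapping.keys g \<union> Poly_Mapping.keys h"
  have "Poly_Mapping.keys (g + h) \<subseteq> ?X" by (rule keys_add)
  then show ?thesis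
    by (simp add: pairing_superset[of ?X] lookup_add algebra_simps sum.distrib)
qed

lemma pairing_diff: "pairing (g - h) F = pairing g F - pairing h F"
  using pairing_add[of "g - h" h F] by simp

lemma pairing_sum: "pairing (sum f X) F = (\<Sum>x\<in>X. pairing (f x) F)"
  by (induction X rule: infinite_finite_induct) (simp_all add: pairing_add)

text \<open>Stated for integers because the scalars that occur are signs of permutations.\<close>

lemma pairing_of_int_mult: "pairing (of_int k * h) F = of_int k * pairing h F"
  by (induction k rule: int_induct[where k = 0])
    (simp_all add: distrib_right left_diff_distrib pairing_add pairing_diff)

lemma pairing_M: "pairing h (M \<beta>) = Poly_Mapping.lookup h \<beta>"
  by (simp add: pairing_def lookup_single when_def in_keys_iff if_distrib
      flip: M_combination_single cong: if_cong)

text \<open>Testing against \<open>M \<beta>\<close> recovers every coefficient, so the element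
  described by \<open>perp\<close> is unique once some \<open>h'\<close> satisfies the
  adjunction.\<close>

lemma perp_eqI:
  assumes "\<And>G. G \<in> QSym \<Longrightarrow> pairing h' G = pairing h (series_mult F G)"
  shows "perp F h = h'"
  unfolding perp_def
proof (rule the_equality)
  fix g assume "\<forall>G\<in>QSym. pairing g G = pairing h (series_mult F G)"
  then have "pairing g (M \<beta>) = pairing h' (M \<beta>)" for \<beta>
    using assms M_in_QSym by simp
  then show "g = h'" by (intro poly_mapping_eqI) (simp add: pairing_M)
qed (use assms in blast)

lemma H_tuple_neg: "r \<in> set as \<Longrightarrow> r < 0 \<Longrightarrow> H_tuple as = 0"
  by (induction as) (auto simp: H_tuple_def H_def)

text \<open>Zero entries disappear because \<open>H 0 = 1\<close>, in the same way as
  \<open>expo\<close> drops zero exponents.\<close>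

lemma H_tuple_nonneg:
  "H_tuple (map (\<lambda>x. int (v x)) xs) = Poly_Mapping.single (Comp (filter (\<lambda>k. k \<noteq> 0) (map v xs))) 1"
proof (induction xs)
  case Nil
  then show ?case by (simp add: H_tuple_def zero_composition_def flip: single_one)
next
  case (Cons x xs)
  have "Comp [k] + Comp (filter (\<lambda>k. k \<noteq> 0) ys) = Comp (k # filter (\<lambda>k. k \<noteq> 0) ys)" if "0 < k" for k ys
    using that by (simp add: plus_composition_def Comp_inverse)
  with Cons show ?case by (auto simp: H_tuple_def H_def mult_single)
qed

text \<open>Pairing with a word reads off one coefficient of \<open>F\<close>. The monomial keeps
  the positions of the word, zeros included, so entries can be lowered in place.\<close>

lemma pairing_H_tuple:
  assumes F: "F \<in> QSym"
  shows "pairing (H_tuple (map v [l..<m])) F =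
    (if \<forall>x\<in>{l..<m}. 0 \<le> v x then F (monom_on {l..<m} (\<lambda>x. nat (v x))) else 0)"
proof (cases "\<forall>x\<in>{l..<m}. 0 \<le> v x")
  case True
  let ?e = "monom_on {l..<m} (\<lambda>x. nat (v x))"
  have "H_tuple (map v [l..<m]) = H_tuple (map (\<lambda>x. int (nat (v x))) [l..<m])"
    using True by (intro arg_cong[where f = H_tuple] map_cong) auto
  also have "\<dots> = Poly_Mapping.single (Comp (expo ?e)) 1"
    by (simp only: H_tuple_nonneg expo_monom_on finite_atLeastLessThan sorted_list_of_set_range)
  finally have "pairing (H_tuple (map v [l..<m])) F = F (initial_monomial (Comp (expo ?e)))"
    by (simp add: pairing_def lookup_M_coords F)
  also have "\<dots> = F ?e" using F by (rule QSym_cong) simp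
  finally show ?thesis using True by simp
next
  case False
  then obtain x where "x \<in> {l..<m}" "v x < 0" by force
  then have "H_tuple (map v [l..<m]) = 0" by (intro H_tuple_neg[of "v x"]) auto
  with False show ?thesis by auto
qed

text \<open>The left side is a coefficient of the product, hence a sum over sets \<open>S\<close> of
  positive entries. The remaining \<open>S\<close> on the right lower a zero entry to -1 and
  contribute nothing. If \<open>v\<close> has a negative entry, it stays negative and both sides
  vanish.\<close>

lemma pairing_H_tuple_F_fund_ones:
  assumes G: "G \<in> QSym"
  shows "pairing (H_tuple (map v [l..<m])) (series_mult (F_fund (ones i)) G) =
    (\<Sum>S | S \<subseteq> {l..<m} \<and> card S = i. pairing (H_tuple (map (\<lambda>x. v x - of_bool (x \<in> S)) [l..<m])) G)"
proof (cases "\<forall>x\<in>{l..<m}. 0 \<le> v x")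
  case True
  let ?A = "{l..<m}"
  have "pairing (H_tuple (map v [l..<m])) (series_mult (F_fund (ones i)) G) =
    (\<Sum>S | S \<subseteq> ?A \<and> card S = i \<and> (\<forall>x\<in>S. 0 < nat (v x)). G (monom_on ?A (\<lambda>x. nat (v x) - of_bool (x \<in> S))))"
    using True by (simp add: pairing_H_tuple series_mult_F_fund_ones_in_QSym[OF G] series_mult_F_fund_ones)
  also have "\<dots> = (\<Sum>S | S \<subseteq> ?A \<and> card S = i.
      if \<forall>x\<in>?A. 0 \<le> v x - of_bool (x \<in> S) then G (monom_on ?A (\<lambda>x. nat (v x - of_bool (x \<in> S)))) else 0)"
  proof (rule sum.mono_neutral_cong_left)
    fix S assume "S \<in> {S. S \<subseteq> ?A \<and> card S = i \<and> (\<forall>x\<in>S. 0 < nat (v x))}"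
    then have "\<forall>x\<in>?A. 0 \<le> v x - of_bool (x \<in> S)" using True by auto
    moreover have "monom_on ?A (\<lambda>x. nat (v x) - of_bool (x \<in> S)) = monom_on ?A (\<lambda>x. nat (v x - of_bool (x \<in> S)))"
      by (intro monom_on_cong) auto
    ultimately show "G (monom_on ?A (\<lambda>x. nat (v x) - of_bool (x \<in> S))) =
      (if \<forall>x\<in>?A. 0 \<le> v x - of_bool (x \<in> S) then G (monom_on ?A (\<lambda>x. nat (v x - of_bool (x \<in> S)))) else 0)"
      by simp
  next
    show "\<forall>S\<in>{S. S \<subseteq> ?A \<and> card S = i} - {S. S \<subseteq> ?A \<and> card S = i \<and> (\<forall>x\<in>S. 0 < nat (v x))}.
      (if \<forall>x\<in>?A. 0 \<le> v x - of_bool (x \<in> S)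
       then G (monom_on ?A (\<lambda>x. nat (v x - of_bool (x \<in> S)))) else 0) = 0"
    proof
      fix S assume "S \<in> {S. S \<subseteq> ?A \<and> card S = i} - {S. S \<subseteq> ?A \<and> card S = i \<and> (\<forall>x\<in>S. 0 < nat (v x))}"
      then obtain x where "x \<in> ?A" "x \<in> S" "\<not> 0 < v x" by auto
      then have "x \<in> ?A" "\<not> 0 \<le> v x - of_bool (x \<in> S)" by auto
      then show "(if \<forall>x\<in>?A. 0 \<le> v x - of_bool (x \<in> S)
         then G (monom_on ?A (\<lambda>x. nat (v x - of_bool (x \<in> S)))) else 0) = 0"
        by (metis (no_types, lifting))
    qed
  qed auto
  finally show ?thesis by (simp add: pairing_H_tuple G)
next
  case False
  then obtain x where x: "x \<in> {l..<m}" "v x < 0" by force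
  then have "\<not> 0 \<le> v x - of_bool (x \<in> S)" for S by simp
  with x have "\<not> (\<forall>x\<in>{l..<m}. 0 \<le> v x - of_bool (x \<in> S))" for S by blast
  with False show ?thesis
    by (simp only: pairing_H_tuple G series_mult_F_fund_ones_in_QSym if_False sum.neutral_const)
qed

section \<open>Noncommutative determinants under the dual operators\<close>

text \<open>
  Rows and columns are indexed by \<open>{l..<m}\<close> rather than by \<open>{1..n}\<close>, so that deleting the first row
  needs no renumbering.
\<close>

definition hdet :: "nat \<Rightarrow> nat \<Rightarrow> (nat \<Rightarrow> int) \<Rightarrow> (nat \<Rightarrow> int) \<Rightarrow> nsym" where
  "hdet l m a t = (\<Sum>\<tau> | \<tau> permutes {l..<m}.
    of_int (sign \<tau>) * H_tuple (map (\<lambda>x. a x + t (\<tau> x)) [l..<m]))"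

text \<open>For a fixed \<open>\<tau>\<close>, lowering the rows in \<open>S\<close> amounts to
  lowering the labels of the columns in \<open>\<tau>\<close> applied to \<open>S\<close>. After
  this reindexing the sets no longer depend on \<open>\<tau>\<close>, and the two sums can be
  exchanged.\<close>

lemma perp_hdet:
  "perp (F_fund (ones i)) (hdet l m a t) =
    (\<Sum>S | S \<subseteq> {l..<m} \<and> card S = i. hdet l m a (\<lambda>x. t x - of_bool (x \<in> S)))"
proof (rule perp_eqI)
  fix G assume G: "G \<in> QSym"
  let ?X = "{S. S \<subseteq> {l..<m} \<and> card S = i}"
  have shift: "(\<Sum>S\<in>?X. pairing (H_tuple (map (\<lambda>x. a x + t (\<tau> x) - of_bool (x \<in> S)) [l..<m])) G)
      = (\<Sum>S\<in>?X. pairing (H_tuple (map (\<lambda>x. a x + (t (\<tau> x) - of_bool (\<tau> x \<in> S))) [l..<m])) G)"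
    if \<tau>: "\<tau> permutes {l..<m}" for \<tau>
  proof (rule sum.reindex_bij_witness[where j = "\<lambda>S. \<tau> ` S" and i = "\<lambda>S. \<tau> -` S"])
    have inj: "inj \<tau>" and surj: "surj \<tau>"
      using \<tau> by (simp_all add: permutes_inj permutes_surj)
    have mem: "\<tau> x \<in> {l..<m} \<longleftrightarrow> x \<in> {l..<m}" for x
      by (rule permutes_in_image[OF \<tau>])
    fix S
    show "\<tau> -` (\<tau> ` S) = S" using inj by (simp add: inj_vimage_image_eq)
    show "\<tau> ` (\<tau> -` S) = S" using surj by (simp add: surj_image_vimage_eq)
    assume S: "S \<in> ?X"
    have "card (\<tau> ` S) = card S" using inj by (intro card_image) (auto intro: inj_on_subset)
    with S show "\<tau> ` S \<in> ?X" using mem by blast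
    have "card (\<tau> -` S) = card S" using inj surj by (intro card_vimage_inj) auto
    with S show "\<tau> -` S \<in> ?X" using mem by blast
    show "pairing (H_tuple (map (\<lambda>x. a x + (t (\<tau> x) - of_bool (\<tau> x \<in> \<tau> ` S))) [l..<m])) G
        = pairing (H_tuple (map (\<lambda>x. a x + t (\<tau> x) - of_bool (x \<in> S)) [l..<m])) G"
      using inj by (simp add: inj_image_mem_iff add_diff_eq)
  qed
  show "pairing (\<Sum>S\<in>?X. hdet l m a (\<lambda>x. t x - of_bool (x \<in> S))) G =
      pairing (hdet l m a t) (series_mult (F_fund (ones i)) G)"
    unfolding hdet_def pairing_sum pairing_of_int_mult pairing_H_tuple_F_fund_ones[OF G]
    by (subst sum.swap) (auto intro!: sum.cong simp only: shift sum_distrib_left[symmetric] mem_Collect_eq)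
qed

lemma hdet_cong: "(\<And>x. x \<in> {l..<m} \<Longrightarrow> t x = u x) \<Longrightarrow> hdet l m a t = hdet l m a u"
proof -
  assume eq: "\<And>x. x \<in> {l..<m} \<Longrightarrow> t x = u x"
  have "map (\<lambda>x. a x + t (\<tau> x)) [l..<m] = map (\<lambda>x. a x + u (\<tau> x)) [l..<m]" if "\<tau> permutes {l..<m}" for \<tau>
    using permutes_in_image[OF that] eq by auto
  then show ?thesis unfolding hdet_def by (intro sum.cong refl) (simp only: mem_Collect_eq)
qed

text \<open>Composing \<open>\<tau>\<close> on the left with a transposition exchanges columns and
  keeps the rows in place, so the order of the noncommuting factors is untouched.\<close>

lemma hdet_transpose:
  assumes "p \<in> {l..<m}" "q \<in> {l..<m}" "p \<noteq> q"
  shows "hdet l m a (t \<circ> transpose p q) = - hdet l m a t"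
proof -
  let ?s = "transpose p q"
  have s: "?s permutes {l..<m}" using assms by (simp add: permutes_swap_id)
  have "sign (?s \<circ> \<tau>) = - sign \<tau>" if "\<tau> permutes {l..<m}" for \<tau>
    using sign_compose[OF permutation_swap_id permutes_imp_permutation[OF _ that]] assms(3)
    by (simp add: sign_swap_id)
  then have "hdet l m a t = (\<Sum>\<tau> | \<tau> permutes {l..<m}.
      - (of_int (sign \<tau>) * H_tuple (map (\<lambda>x. a x + (t \<circ> ?s) (\<tau> x)) [l..<m])))"
    unfolding hdet_def by (subst setum_permutations_compose_left[OF s]) (intro sum.cong, auto)
  then show ?thesis by (simp add: hdet_def sum_negf)
qed

lemma hdet_eq_0:
  assumes "p \<in> {l..<m}" "q \<in> {l..<m}" "p \<noteq> q" "t p = t q"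
  shows "hdet l m a t = 0"
proof -
  have "t \<circ> transpose p q = t" using assms(4) by (auto simp: transpose_def)
  then have "hdet l m a t = - hdet l m a t" using hdet_transpose[OF assms(1-3), of a t] by simp
  \<comment> \<open>Passing to rational coefficients allows division by 2.\<close>
  then have "Poly_Mapping.lookup (hdet l m a t) \<alpha> = - Poly_Mapping.lookup (hdet l m a t) \<alpha>" for \<alpha>
    by (metis lookup_uminus)
  then show ?thesis by (intro poly_mapping_eqI) simp
qed

lemma initial_segmentI:
  assumes "S \<subseteq> {l..<m}" "\<And>p. l \<le> p \<Longrightarrow> Suc p \<in> S \<Longrightarrow> p \<in> S"
  shows "S = {l..<l + card S}"
proof (cases "S = {}")
  case False
  have fin: "finite S" using assms(1) finite_subset by blast
  have "{l..Max S} \<subseteq> S"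
  proof
    fix x assume "x \<in> {l..Max S}"
    then have "x \<le> Max S" "l \<le> x" by auto
    then show "x \<in> S"
    proof (induction rule: inc_induct)
      case base
      show ?case using fin False by simp
    next
      case (step n)
      then show ?case using assms(2)[of n] by simp
    qed
  qed
  moreover have "S \<subseteq> {l..Max S}" using assms(1) fin by auto
  ultimately obtain k where k: "S = {l..<k}" using atLeastLessThanSuc_atLeastAtMost by blast
  then have "l < k" using False by auto
  with k show ?thesis by simp
qed simp

text \<open>If \<open>S\<close> is not an initial segment, it contains some \<open>Suc p\<close> but
  not \<open>p\<close>, and both columns then carry the label \<open>p\<close>. The zero branch
  later makes the sum in \<open>B\<close> finite.\<close>

lemma perp_hdet_int:
  "perp (F_fund (ones i)) (hdet l m a int) =
    (if i \<le> m - l then hdet l m a (\<lambda>x. int x - of_bool (x < l + i)) else 0)"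
proof -
  let ?X = "{S. S \<subseteq> {l..<m} \<and> card S = i}"
  let ?f = "\<lambda>S. hdet l m a (\<lambda>x. int x - of_bool (x \<in> S))"
  have z: "?f S = 0" if S: "S \<subseteq> {l..<m}" "S \<noteq> {l..<l + card S}" for S
  proof -
    obtain p where "l \<le> p" "Suc p \<in> S" "p \<notin> S" using initial_segmentI[OF S(1)] S(2) by blast
    then show ?thesis using S(1) by (intro hdet_eq_0[of p _ _ "Suc p"]) auto
  qed
  show ?thesis
  proof (cases "i \<le> m - l")
    case True
    have "(\<Sum>S\<in>?X. ?f S) = (\<Sum>S\<in>{{l..<l + i}}. ?f S)"
      by (rule sum.mono_neutral_right) (use True z in auto)
    also have "\<dots> = hdet l m a (\<lambda>x. int x - of_bool (x < l + i))"
      by (auto intro: hdet_cong)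
    finally show ?thesis using True by (simp add: perp_hdet)
  next
    case False
    then have "card S \<noteq> i" if "S \<subseteq> {l..<m}" for S
      using card_mono[OF _ that] by auto
    then have "?X = {}" by auto
    then have "sum ?f ?X = 0" by (metis sum.empty)
    then show ?thesis using False by (simp add: perp_hdet)
  qed
qed

section \<open>Row expansion and the operators \<open>B\<close>\<close>

text \<open>Each permutation is uniquely \<open>transpose l b \<circ> q\<close> with
  \<open>q\<close> fixing \<open>l\<close>, and it sends row \<open>l\<close> to column
  \<open>b\<close>. The sign is -1 for every \<open>b \<noteq> l\<close>, not alternating, because
  the minor keeps the label of column \<open>l\<close> in position \<open>b\<close>.\<close>

lemma hdet_expand_first_row:
  assumes "l < m"
  shows "hdet l m a t = (\<Sum>b = l..<m. (if b = l then 1 else - 1) *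
    (H (a l + t b) * hdet (Suc l) m a (t \<circ> transpose l b)))"
proof -
  have ins: "{l..<m} = insert l {Suc l..<m}" and upt: "[l..<m] = l # [Suc l..<m]"
    using assms by (auto simp: upt_conv_Cons)
  have "of_int (sign (transpose l b \<circ> q)) * H_tuple (map (\<lambda>x. a x + t ((transpose l b \<circ> q) x)) [l..<m])
      = (if b = l then 1 else - 1) * (H (a l + t b) * (of_int (sign q) *
        H_tuple (map (\<lambda>x. a x + (t \<circ> transpose l b) (q x)) [Suc l..<m])))"
    if q: "q permutes {Suc l..<m}" for b q
  proof -
    have "q l = l" using q by (simp add: permutes_not_in)
    moreover have "sign (transpose l b \<circ> q) = (if b = l then 1 else - 1) * sign q"
      using sign_compose[OF permutation_swap_id permutes_imp_permutation[OF _ q]]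
      by (simp add: sign_swap_id)
    \<comment> \<open>The sign is central and may pass the first factor, while the order of the
      other factors is fixed.\<close>
    moreover have "of_int k * (x * y) = x * (of_int k * y)" for k and x y :: nsym
      by (metis mult.assoc mult_of_int_commute)
    ultimately show ?thesis
      unfolding upt by (simp add: H_tuple_def)
  qed
  then show ?thesis
    unfolding hdet_def ins
    by (subst sum_over_permutations_insert) (simp_all add: sum_distrib_left o_def)
qed

text \<open>Both sides carry all labels from \<open>l\<close> to \<open>m - 1\<close> except
  \<open>b\<close>: increasing on the left, with \<open>l\<close> moved to position \<open>b\<close>
  on the right, as the row expansion produces it.\<close>

lemma hdet_cycle:
  assumes "l < b" "b < m"
  shows "hdet (Suc l) m a (\<lambda>x. int x - of_bool (x \<le> b)) =
    (- 1) ^ (b - Suc l) * hdet (Suc l) m a (int \<circ> transpose l b)"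
proof -
  \<comment> \<open>\<open>w c\<close> has the label \<open>l\<close> in position \<open>c\<close>; it moves from \<open>Suc l\<close> to \<open>b\<close> by adjacent transpositions\<close>
  define w where "w c x = (if x < c then int x else if x = c then int l else if x \<le> b then int x - 1 else int x)" for c x
  have rotate: "hdet (Suc l) m a (w (Suc c)) = - hdet (Suc l) m a (w c)" if "l < c" "c < b" for c
  proof -
    have "w (Suc c) = w c \<circ> transpose c (Suc c)"
      using that by (auto simp: w_def transpose_def fun_eq_iff)
    then show ?thesis using that assms by (simp add: hdet_transpose)
  qed
  have "hdet (Suc l) m a (w b) = (- 1) ^ (b - c) * hdet (Suc l) m a (w c)" if "c \<le> b" "l < c" for c
    using that
  proof (induction rule: inc_induct)
    case (step n)
    have "b - n = Suc (b - Suc n)" using step.hyps by simp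
    then show ?case using step.IH step.prems step.hyps rotate[of n] by simp
  qed simp
  from this[of "Suc l"] assms
  have "hdet (Suc l) m a (w b) = (- 1) ^ (b - Suc l) * hdet (Suc l) m a (w (Suc l))" by simp
  moreover have "hdet (Suc l) m a (w (Suc l)) = hdet (Suc l) m a (\<lambda>x. int x - of_bool (x \<le> b))"
    using assms by (intro hdet_cong) (auto simp: w_def)
  moreover have "hdet (Suc l) m a (w b) = hdet (Suc l) m a (int \<circ> transpose l b)"
    using assms by (intro hdet_cong) (auto simp: w_def transpose_def)
  \<comment> \<open>The induction gives the equation in the opposite direction; a sign is its own
    inverse.\<close>
  moreover have "(- 1) ^ k * ((- 1) ^ k * x) = x" for k and x :: nsym
    by (cases "even k") simp_all
  ultimately show ?thesis by metis
qed

text \<open>The summand \<open>i\<close> of \<open>B\<close> is the term of column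
  \<open>b = l + i\<close> in the row expansion. For \<open>i > 0\<close> the sign of
  \<open>hdet_cycle\<close> has exponent \<open>i - 1\<close>, which turns the sign of
  \<open>B\<close> into the constant -1.\<close>

lemma B_hdet:
  assumes "l < m"
  shows "B (a l + int l) (hdet (Suc l) m a int) = hdet l m a int"
proof -
  let ?g = "\<lambda>i. (- 1) ^ i * H (a l + int l + int i) * perp (F_fund (ones i)) (hdet (Suc l) m a int)"
  have "B (a l + int l) (hdet (Suc l) m a int) = sum ?g {..m - Suc l}"
    unfolding B_def by (rule Sum_any.expand_superset) (auto simp: perp_hdet_int split: if_splits)
  also have "\<dots> = (\<Sum>b = l..<m. (if b = l then 1 else - 1) *
      (H (a l + int b) * hdet (Suc l) m a (int \<circ> transpose l b)))"
  proof (rule sum.reindex_bij_witness[where j = "\<lambda>i. l + i" and i = "\<lambda>b. b - l"])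
    fix i assume i: "i \<in> {..m - Suc l}"
    show "(if l + i = l then 1 else - 1) *
        (H (a l + int (l + i)) * hdet (Suc l) m a (int \<circ> transpose l (l + i))) = ?g i"
    proof (cases i)
      case 0
      have "hdet (Suc l) m a (\<lambda>x. int x - of_bool (x < Suc l)) = hdet (Suc l) m a int"
        by (intro hdet_cong) auto
      then show ?thesis by (simp add: 0 perp_hdet_int)
    next
      case (Suc k)
      have "hdet (Suc l) m a (\<lambda>x. int x - of_bool (x < Suc l + i)) =
          (- 1) ^ k * hdet (Suc l) m a (int \<circ> transpose l (l + i))"
        using hdet_cycle[of l "l + i" m a] i assms Suc by (simp add: less_Suc_eq_le)
      then have "?g i = (- 1) ^ Suc k * H (a l + int l + int i) *
          ((- 1) ^ k * hdet (Suc l) m a (int \<circ> transpose l (l + i)))"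
        using i Suc by (simp add: perp_hdet_int)
      also have "\<dots> = - (H (a l + int l + int i) * hdet (Suc l) m a (int \<circ> transpose l (l + i)))"
        by (cases "even k") simp_all
      finally show ?thesis using Suc by (simp add: ac_simps)
    qed
  qed (use assms in auto)
  also have "\<dots> = hdet l m a int"
    by (rule hdet_expand_first_row[OF assms, symmetric])
  finally show ?thesis .
qed

text \<open>Downward induction on \<open>l\<close> adds one row on top at each step, starting from
  the empty determinant 1. The shift \<open>- int x\<close> cancels the \<open>+ int l\<close> in
  \<open>B_hdet\<close>.\<close>

lemma immaculate_eq_hdet:
  assumes "l \<le> m"
  shows "immaculate (map a [l..<m]) = hdet l m (\<lambda>x. a x - int x) int"
  using assms
proof (induction rule: inc_induct)
  case base
  show ?case by (simp add: immaculate_def hdet_def H_tuple_def)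
next
  case (step l)
  have "immaculate (map a [l..<m]) = B (a l) (immaculate (map a [Suc l..<m]))"
    using step.hyps by (simp add: immaculate_def upt_conv_Cons)
  then show ?case using step B_hdet[of l m "\<lambda>x. a x - int x"] by simp
qed

theorem theorem3p17:
  fixes \<alpha> :: composition and m :: nat
  assumes "m = length (parts \<alpha>)"
  shows "immaculate (map int (parts \<alpha>)) =
    (\<Sum>\<sigma> | \<sigma> permutes {1..m}.
      of_int (sign \<sigma>) *
      H_tuple (map (\<lambda>i. int (parts \<alpha> ! (i - 1)) + int (\<sigma> i) - int i) [1..<m + 1]))"
proof -
  \<comment> \<open>Rows are numbered from 1, list positions from 0.\<close>
  have "map int (parts \<alpha>) = map (\<lambda>i. int (parts \<alpha> ! (i - 1))) [1..<m + 1]"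
    by (rule nth_equalityI) (simp_all add: assms nth_upt del: upt_Suc)
  then have "immaculate (map int (parts \<alpha>)) =
      hdet 1 (m + 1) (\<lambda>i. int (parts \<alpha> ! (i - 1)) - int i) int"
    using immaculate_eq_hdet[of 1 "m + 1" "\<lambda>i. int (parts \<alpha> ! (i - 1))"] by simp
  moreover have "{1..<m + 1} = {1..m}" by auto
  ultimately show ?thesis by (simp add: hdet_def add_diff_eq diff_add_eq del: upt_Suc)
qed

end
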